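(* Consider any run of successive cell selections, and let $A_k$ be the active set after $k$ selections, where $k<K$ (so the run has not terminated). Then every current cell with respect to $A_k$ contains at least one free original gap.
   Context: Fix $L>0$ and integers $n,m\ge 1$. On the circle $\mathbb{S}^1_L=\mathbb{R}/L\mathbb{Z}$ (clockwise means in the direction of increasing coordinate) let $x_1,\dots,x_n$ (source atoms) and $y_1,\dots,y_m$ (target atoms) be pairwise distinct points; $N=n+m$, $K=\min(n,m)$. Let $z_1,\dots,z_N$ be all atoms in clockwise cyclic order, $z_{N+1}=z_1$; the original gaps are the $N$ open clockwise arcs $G_i$ from $z_i$ to $z_{i+1}$. Cells. Given an active set $A$ of atoms, let $u_1,\dots,u_r$ ($r\ge1$) be the inactive atoms (those not in $A$) in clockwise cyclic order, $u_{r+1}=u_1$. The current cells with respect to $A$ are the $r$ closed clockwise arcs from $u_i$ to $u_{i+1}$ (for $r=2$ these are the two complementary arcs; for $r=1$ the single cell is the whole circle traversed once from $u_1$ to itself). A current cell is a candidate if its two endpoints are of opposite type (one source, one target). Selections. A run of successive cell selections starts from $A_0=\varnothing$; at step $j\ge1$ a cell $\mathcal C_j$ that is a candidate with respect to $A_{j-1}$ is selected and its two endpoints $u,v$ are activated: $A_j=A_{j-1}\cup\{u,v\}$. The run terminates after $K$ selections. An original gap is called used once it lies inside some selected cell, and free if it lies inside no cell selected so far. *)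

theory Defs
  imports Complex_Main "HOL-Library.Real_Mod"
begin

text \<open>
  The circle of length \<open>L\<close> is modelled by canonical representatives modulo \<open>L\<close>; on these,
  increasing order of reals is a clockwise cyclic order.
\<close>

definition circle :: "real \<Rightarrow> real set" where
  "circle L = {0..<L}"

text \<open>
  An arc from a point to itself is one full turn, so that the only cell in the presence of
  a single inactive atom is the whole circle.
\<close>

definition arc_length :: "real \<Rightarrow> real \<Rightarrow> real \<Rightarrow> real" where
  "arc_length L u v = (if u = v then L else (v - u) rmod L)"

definition closed_arc :: "real \<Rightarrow> real \<Rightarrow> real \<Rightarrow> real set" where
  "closed_arc L u v = (\<lambda>t. (u + t) rmod L) ` {0..arc_length L u v}"

definition open_arc :: "real \<Rightarrow> real \<Rightarrow> real \<Rightarrow> real set" where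
  "open_arc L u v = (\<lambda>t. (u + t) rmod L) ` {0<..<arc_length L u v}"

text \<open>Pairs of cyclically consecutive points of a finite set of representatives:\<close>

definition consecutive :: "real set \<Rightarrow> (real \<times> real) set" where
  "consecutive U =
     (let us = sorted_list_of_set U; r = length us
      in {(us ! i, us ! (Suc i mod r)) | i. i < r})"

text \<open>
  Below, \<open>S\<close> and \<open>T\<close> are the sets of source and target atoms and \<open>A\<close> is the active set. A cell
  is represented by its ordered pair of endpoints; as a subset of the circle it is the
  \<open>cell_arc\<close> of that pair. The order matters: with two inactive atoms, the two cells have the
  same endpoints.
\<close>

definition gaps :: "real \<Rightarrow> real set \<Rightarrow> real set \<Rightarrow> real set set" where
  "gaps L S T = {open_arc L u v | u v. (u, v) \<in> consecutive (S \<union> T)}"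

definition cells :: "real set \<Rightarrow> real set \<Rightarrow> real set \<Rightarrow> (real \<times> real) set" where
  "cells S T A = consecutive ((S \<union> T) - A)"

definition cell_arc :: "real \<Rightarrow> real \<times> real \<Rightarrow> real set" where
  "cell_arc L C = closed_arc L (fst C) (snd C)"

definition candidate :: "real set \<Rightarrow> real set \<Rightarrow> real set \<Rightarrow> real \<times> real \<Rightarrow> bool" where
  "candidate S T A C \<longleftrightarrow>
     C \<in> cells S T A \<and> (fst C \<in> S \<and> snd C \<in> T \<or> fst C \<in> T \<and> snd C \<in> S)"

text \<open>The selected cells are listed from index 0: entry \<open>j\<close> is selected at step \<open>Suc j\<close>.\<close>

primrec active :: "(real \<times> real) list \<Rightarrow> nat \<Rightarrow> real set" where
  "active cs 0 = {}"
| "active cs (Suc j) = active cs j \<union> {fst (cs ! j), snd (cs ! j)}"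

text \<open>Runs may be stopped early; they are complete when the length bound is attained.\<close>

definition is_run :: "real set \<Rightarrow> real set \<Rightarrow> (real \<times> real) list \<Rightarrow> bool" where
  "is_run S T cs \<longleftrightarrow>
     length cs \<le> min (card S) (card T) \<and>
     (\<forall>j < length cs. candidate S T (active cs j) (cs ! j))"

definition free_gap ::
  "real \<Rightarrow> real set \<Rightarrow> real set \<Rightarrow> (real \<times> real) list \<Rightarrow> nat \<Rightarrow> real set \<Rightarrow> bool" where
  "free_gap L S T cs k G \<longleftrightarrow>
     G \<in> gaps L S T \<and> (\<forall>j < k. \<not> G \<subseteq> cell_arc L (cs ! j))"

end

theory Submission
  imports Defs
begin

text \<open>
  Induct on the number of selections. Initially every cell is itself a gap. When a cell
  \<open>(u, v)\<close> is selected, a new cell \<open>(p, q)\<close> starts at a point \<open>p \<noteq> u\<close>, so it contains the old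
  cell starting at \<open>p\<close>, which differs from \<open>(u, v)\<close>. That old cell contains a previously free
  gap, and this gap stays free because distinct cells overlap only in atoms.
\<close>

text \<open>Sums \<open>u + t\<close> with \<open>0 \<le> t \<le> L\<close> and differences of
  representatives are at most one turn away from \<open>circle L\<close>, so these three shifts
  cover every reduction below.\<close>

lemma rmod_eqI:
  fixes L a b :: real
  assumes "0 \<le> b" "b < L" "a = b \<or> a = b + L \<or> a = b - L"
  shows "a rmod L = b"
  using assms rmod_unique[of b L a 0] rmod_unique[of b L a 1] rmod_unique[of b L a "-1"]
  by auto

text \<open>For \<open>u = v\<close> the second branch evaluates to \<open>L\<close>, so the
  full-turn convention merges with the wrap-around case.\<close>

lemma arc_length_eq:
  assumes "u \<in> circle L" "v \<in> circle L"
  shows "arc_length L u v = (if u < v then v - u else v - u + L)"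
  using assms unfolding arc_length_def circle_def by (auto intro!: rmod_eqI)

text \<open>Turning by \<open>t \<le> L\<close> wraps past \<open>L\<close> at most once, so the
  parameter that leads to \<open>w\<close> is \<open>w - u\<close> or \<open>w - u + L\<close>.
  Leaving \<open>I\<close> general serves closed and open arcs alike.\<close>

lemma turn_image_eq:
  assumes u: "u \<in> circle L" and I: "I \<subseteq> {0..L}"
  shows "(\<lambda>t. (u + t) rmod L) ` I =
    {w \<in> circle L. w - u \<in> I \<or> w - u + L \<in> I}"
proof (intro equalityI subsetI)
  fix w assume "w \<in> (\<lambda>t. (u + t) rmod L) ` I"
  then obtain t where t: "t \<in> I" "w = (u + t) rmod L" by blast
  with I have "0 \<le> t" "t \<le> L" by auto
  show "w \<in> {w \<in> circle L. w - u \<in> I \<or> w - u + L \<in> I}"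
  proof (cases "u + t < L")
    case True
    then have "w = u + t"
      using u \<open>0 \<le> t\<close> unfolding t(2) circle_def by (intro rmod_eqI) auto
    then show ?thesis using True u t \<open>0 \<le> t\<close> by (auto simp: circle_def)
  next
    case False
    then have "w = u + t - L"
      using u \<open>t \<le> L\<close> unfolding t(2) circle_def by (intro rmod_eqI) auto
    then show ?thesis using False u t \<open>t \<le> L\<close> by (auto simp: circle_def)
  qed
next
  fix w assume w: "w \<in> {w \<in> circle L. w - u \<in> I \<or> w - u + L \<in> I}"
  then have "(u + (w - u)) rmod L = w" "(u + (w - u + L)) rmod L = w"
    by (auto simp: circle_def intro!: rmod_eqI)
  then show "w \<in> (\<lambda>t. (u + t) rmod L) ` I"
    using w by (metis (mono_tags, lifting) imageI mem_Collect_eq)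
qed

text \<open>Cutting the circle at 0 turns an arc into one or two real intervals, which reduces the
  later geometry to linear arithmetic.\<close>

lemma closed_arc_eq:
  assumes "u \<in> circle L" "v \<in> circle L"
  shows "closed_arc L u v = (if u < v then {u..v} else {u..<L} \<union> {0..v})"
proof -
  have "{0..arc_length L u v} \<subseteq> {0..L}"
    using assms by (auto simp: arc_length_eq circle_def)
  note eq = turn_image_eq[OF assms(1) this, folded closed_arc_def, unfolded arc_length_eq[OF assms]]
  show ?thesis
    unfolding eq using assms by (intro set_eqI) (cases "u < v"; simp add: circle_def; argo)
qed

lemma open_arc_eq:
  assumes "u \<in> circle L" "v \<in> circle L"
  shows "open_arc L u v = (if u < v then {u<..<v} else {u<..<L} \<union> {0..<v})"
proof -
  have "{0<..<arc_length L u v} \<subseteq> {0..L}"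
    using assms by (auto simp: arc_length_eq circle_def)
  note eq = turn_image_eq[OF assms(1) this, folded open_arc_def, unfolded arc_length_eq[OF assms]]
  show ?thesis
    unfolding eq using assms by (intro set_eqI) (cases "u < v"; simp add: circle_def; argo)
qed

lemma open_arc_nonempty:
  assumes "u \<in> circle L" "v \<in> circle L"
  shows "open_arc L u v \<noteq> {}"
  using assms by (auto simp: open_arc_eq circle_def)

lemma open_arc_subset_closed_arc: "open_arc L u v \<subseteq> closed_arc L u v"
  unfolding open_arc_def closed_arc_def by (intro image_mono) auto

lemma consecutive_exists:
  assumes "finite U" "u \<in> U"
  obtains v where "(u, v) \<in> consecutive U"
proof -
  from assms obtain i where "i < length (sorted_list_of_set U)" "u = sorted_list_of_set U ! i"
    by (metis in_set_conv_nth set_sorted_list_of_set)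
  then show ?thesis
    by (intro that) (auto simp: consecutive_def Let_def)
qed

text \<open>The last fact says that no point of \<open>U\<close> lies strictly between
  \<open>u\<close> and \<open>v\<close> clockwise. It is phrased by the linear order to match the
  case split of the arc formulas.\<close>

lemma consecutiveD:
  assumes "finite U" "(u, v) \<in> consecutive U"
  shows "u \<in> U" "v \<in> U"
    "w \<in> U \<Longrightarrow> if u < v then w \<le> u \<or> v \<le> w else v \<le> w \<and> w \<le> u"
proof -
  define us where "us = sorted_list_of_set U"
  have us: "set us = U" "sorted us" "distinct us"
    using assms(1) by (auto simp: us_def)
  obtain i where i: "i < length us" "u = us ! i" "v = us ! (Suc i mod length us)"
    using assms(2) unfolding consecutive_def Let_def us_def[symmetric] by blast
  moreover have "Suc i mod length us < length us"
    using i(1) by (intro mod_less_divisor) auto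
  ultimately show "u \<in> U" "v \<in> U"
    using us(1) by auto
  assume "w \<in> U"
  then obtain j where j: "j < length us" "w = us ! j"
    using us(1) by (metis in_set_conv_nth)
  show "if u < v then w \<le> u \<or> v \<le> w else v \<le> w \<and> w \<le> u"
  proof (cases "Suc i < length us")
    case True
    then have "v = us ! Suc i" using i by simp
    moreover from this have "u < v"
      using us True i sorted_wrt_nth_less[of "(<)" us i "Suc i"]
      by (simp add: strict_sorted_iff)
    moreover have "w \<le> u \<or> v \<le> w"
      using sorted_nth_mono[OF us(2)] i j True \<open>v = us ! Suc i\<close>
      by (metis not_less_eq_eq)
    ultimately show ?thesis by simp
  next
    \<comment> \<open>The last index is followed by index 0: \<open>u\<close> is the maximum and
      \<open>v\<close> the minimum of \<open>U\<close>, with \<open>u = v\<close> when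
      \<open>U\<close> is a singleton.\<close>
    case False
    then have "Suc i = length us" using i by simp
    moreover from this have "v = us ! 0" using i by simp
    ultimately have "v \<le> w" "w \<le> u" "v \<le> u"
      using sorted_nth_mono[OF us(2)] i j by auto
    then show ?thesis by simp
  qed
qed

text \<open>Clockwise from \<open>p\<close>, the point \<open>s\<close> is the first one of
  \<open>U\<close> to be met, so the way to \<open>q\<close> covers the arc to \<open>s\<close>; for
  \<open>q = p\<close> it is the whole circle.\<close>

lemma consecutive_subarc:
  assumes "finite U" "U \<subseteq> circle L" "(p, s) \<in> consecutive U" "q \<in> U"
  shows "closed_arc L p s \<subseteq> closed_arc L p q"
proof -
  note D = consecutiveD[OF assms(1,3)]
  have "p \<in> circle L" "s \<in> circle L" "q \<in> circle L"
    using D assms by auto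
  then show ?thesis
    using D(3)[OF assms(4)] by (auto simp: closed_arc_eq circle_def split: if_splits)
qed

text \<open>Since \<open>t\<close> is not in \<open>U\<close>, it is interior to both arcs. Hence
  \<open>u\<close> and \<open>p\<close> are both the last point of \<open>U\<close> before
  \<open>t\<close>, and \<open>v\<close> and \<open>q\<close> are both the first one after
  it.\<close>

lemma consecutive_arcs_overlap:
  assumes U: "finite U" "U \<subseteq> circle L"
    and c: "(u, v) \<in> consecutive U" "(p, q) \<in> consecutive U"
    and t: "t \<in> closed_arc L u v" "t \<in> closed_arc L p q" "t \<notin> U"
  shows "(u, v) = (p, q)"
proof -
  note D = consecutiveD[OF U(1) c(1)] and E = consecutiveD[OF U(1) c(2)]
  have circ: "u \<in> circle L" "v \<in> circle L" "p \<in> circle L" "q \<in> circle L"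
    using D E U by auto
  have "t \<noteq> u" "t \<noteq> v" "t \<noteq> p" "t \<noteq> q"
    using D E t by auto
  then show ?thesis
    using t(1,2) circ D(3)[OF E(1)] D(3)[OF E(2)] E(3)[OF D(1)] E(3)[OF D(2)]
    by (simp add: closed_arc_eq circle_def split: if_splits; argo)
qed

lemma consecutive_open_arc_disjoint:
  assumes "finite U" "U \<subseteq> circle L" "(u, v) \<in> consecutive U"
  shows "open_arc L u v \<inter> U = {}"
proof -
  note D = consecutiveD[OF assms(1,3)]
  have "u \<in> circle L" "v \<in> circle L" using D assms by auto
  then show ?thesis
    using D(3) by (fastforce simp: open_arc_eq split: if_splits)
qed

text \<open>A gap has a point, and that point is no atom at all. It therefore avoids the inactive
  atoms for every \<open>A\<close> and can lie in only one cell.\<close>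

lemma gap_subset_unique_cell:
  assumes fin: "finite (S \<union> T)" and circ: "S \<union> T \<subseteq> circle L"
    and G: "G \<in> gaps L S T"
    and c: "c \<in> cells S T A" "c' \<in> cells S T A"
    and sub: "G \<subseteq> cell_arc L c" "G \<subseteq> cell_arc L c'"
  shows "c = c'"
proof -
  obtain a b where ab: "(a, b) \<in> consecutive (S \<union> T)" "G = open_arc L a b"
    using G by (auto simp: gaps_def)
  have "a \<in> circle L" "b \<in> circle L"
    using consecutiveD(1,2)[OF fin ab(1)] circ by auto
  then obtain t where t: "t \<in> G"
    using open_arc_nonempty ab(2) by blast
  then have "t \<notin> S \<union> T"
    using consecutive_open_arc_disjoint[OF fin circ ab(1)] ab(2) by blast
  moreover have "finite (S \<union> T - A)" "S \<union> T - A \<subseteq> circle L"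
    using fin circ by auto
  ultimately show ?thesis
    using consecutive_arcs_overlap[of "S \<union> T - A" L "fst c" "snd c" "fst c'" "snd c'" t] c sub t
    by (auto simp: cells_def cell_arc_def prod_eq_iff)
qed

lemma cell_contains_free_gap:
  assumes fin: "finite (S \<union> T)" and circ: "S \<union> T \<subseteq> circle L"
    and cand: "\<And>j. j < k \<Longrightarrow> candidate S T (active cs j) (cs ! j)"
    and C: "C \<in> cells S T (active cs k)"
  shows "\<exists>G. free_gap L S T cs k G \<and> G \<subseteq> cell_arc L C"
  using cand C
\<comment> \<open>\<open>C\<close> has to vary, because the induction hypothesis is applied to the
  old cell \<open>(p, s)\<close>.\<close>
proof (induction k arbitrary: C)
  case 0
  then have "open_arc L (fst C) (snd C) \<in> gaps L S T"
    unfolding gaps_def cells_def by (cases C) auto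
  then show ?case
    by (intro exI[of _ "open_arc L (fst C) (snd C)"])
      (simp add: free_gap_def cell_arc_def open_arc_subset_closed_arc)
next
  case (Suc k)
  define U where "U = S \<union> T - active cs k"
  define U' where "U' = S \<union> T - active cs (Suc k)"
  have U: "finite U" "finite U'" "U \<subseteq> circle L" "U' = U - {fst (cs ! k), snd (cs ! k)}"
    using fin circ by (auto simp: U_def U'_def)
  obtain p q where C: "C = (p, q)" by fastforce
  have "(p, q) \<in> consecutive U'"
    using Suc.prems(2) unfolding C cells_def U'_def .
  note pq = consecutiveD(1,2)[OF U(2) this]
  \<comment> \<open>Being inactive after the selection, \<open>p\<close> was inactive before it and
    so started an old cell.\<close>
  then obtain s where s: "(p, s) \<in> consecutive U"
    using consecutive_exists[OF U(1)] U(4) by blast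
  then have "(p, s) \<in> cells S T (active cs k)"
    by (simp add: cells_def U_def)
  moreover from Suc.IH[OF _ this] Suc.prems(1) obtain G where
    G: "free_gap L S T cs k G" "G \<subseteq> cell_arc L (p, s)"
    by auto
  moreover have "cs ! k \<in> cells S T (active cs k)"
    using Suc.prems(1) by (auto simp: candidate_def)
  \<comment> \<open>The first endpoints differ: that of \<open>cs ! k\<close> has just been
    activated, while \<open>p\<close> is still inactive.\<close>
  moreover have "cs ! k \<noteq> (p, s)"
    using pq(1) U(4) by auto
  ultimately have "\<not> G \<subseteq> cell_arc L (cs ! k)"
    using gap_subset_unique_cell[OF fin circ] unfolding free_gap_def by blast
  then have "free_gap L S T cs (Suc k) G"
    using G(1) by (auto simp: free_gap_def less_Suc_eq)
  moreover have "G \<subseteq> cell_arc L C"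
    using G(2) consecutive_subarc[OF U(1,3) s, of q] pq(2) U(4) C
    by (auto simp: cell_arc_def)
  ultimately show ?case by blast
qed

theorem lemma1:
  fixes L :: real and n m k :: nat and x y :: "nat \<Rightarrow> real"
    and S T :: "real set" and cs :: "(real \<times> real) list" and C :: "real \<times> real"
  assumes "L > 0" and "n \<ge> 1" and "m \<ge> 1"
    and "S = x ` {1..n}" and "T = y ` {1..m}"
    and "S \<subseteq> circle L" and "T \<subseteq> circle L"
    and "inj_on x {1..n}" and "inj_on y {1..m}" and "S \<inter> T = {}"
    and "is_run S T cs"
    and "k \<le> length cs" and "k < min n m"
    and "C \<in> cells S T (active cs k)"
  shows "\<exists>G. free_gap L S T cs k G \<and> G \<subseteq> cell_arc L C"
proof (rule cell_contains_free_gap)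
  show "finite (S \<union> T)" "S \<union> T \<subseteq> circle L"
    using assms by auto
  show "candidate S T (active cs j) (cs ! j)" if "j < k" for j
    \<comment> \<open>By \<open>k \<le> length cs\<close>, every \<open>j < k\<close> indexes an
      actual selection of the run.\<close>
    using assms that by (auto simp: is_run_def)
  show "C \<in> cells S T (active cs k)" by fact
qed

end
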